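(* For every name $Q$: if $\eta\,Q\,Q$ and $\neg(Q\equiv\mathit{Universe})$, then $\mathit{boundaryM}\,Q \approx \Lambda$.
   Context: Setting: a Coq formalization (classical logic) of Leśniewski's Ontology and Mereology. There is a type $N$ of names and a primitive relation $\eta : N\to N\to\mathrm{Prop}$ satisfying Leśniewski's ontological axiom: $\eta\,A\,b \leftrightarrow \big((\exists C,\ \eta\,C\,A)\wedge(\forall C\,D,\ \eta\,C\,A\wedge\eta\,D\,A\to\eta\,C\,D)\wedge(\forall C,\ \eta\,C\,A\to\eta\,C\,b)\big)$. $A$ is an individual iff $\eta\,A\,A$. For names $a,b$: $\eta\,P\,(a\cap b)\leftrightarrow(\eta\,P\,a\wedge\eta\,P\,b)$; $a\approx b$ means $\forall P,\ \eta\,P\,a\leftrightarrow\eta\,P\,b$; $P\equiv Q$ means $\eta\,P\,Q\wedge\eta\,Q\,P$; $\Lambda$ is the empty name (no $P$ with $\eta\,P\,\Lambda$); $V$ is the universal name ($\eta\,P\,V\leftrightarrow\eta\,P\,P$). Mereology: $pt:N\to N$ ($\eta\,B\,(pt\,A)$: $B$ is a part of $A$) satisfying Leśniewski's mereology axioms (part-of is a partial order on individuals; every non-empty name has a unique m-class). M-class: $\eta\,A\,(klass\,a)$ iff $\eta\,A\,A$, $\forall B,\ \eta\,B\,a\to\eta\,B\,(pt\,A)$, and $\forall B,\ \eta\,B\,(pt\,A)\to\exists C\,D,\ \eta\,C\,a\wedge\eta\,D\,(pt\,C)\wedge\eta\,D\,(pt\,B)$. $\eta\,P\,(ext\,Q)$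 iff $P,Q$ are individuals having no common part. $\eta\,P\,\mathit{Universe}$ iff $\eta\,P\,(klass\,V)$. $\eta\,P\,(\mathit{compl}\,Q)$ iff $\eta\,Q\,(pt\,\mathit{Universe})$ and $\eta\,P\,(klass\,((pt\,\mathit{Universe})\cap(ext\,Q)))$ (mereological complement relative to $\mathit{Universe}$). Interior: $\eta\,P\,(\mathit{interior}\,Q)$ iff $\eta\,Q\,Q\wedge\eta\,P\,Q$. Closure: $\eta\,P\,(\mathit{closure}\,Q)$ iff $\eta\,Q\,Q$ and $\exists R\,S,\ \eta\,R\,(\mathit{compl}\,Q)\wedge\eta\,S\,(\mathit{interior}\,R)\wedge\eta\,P\,(\mathit{compl}\,S)$. Mereological boundary: $\eta\,P\,(\mathit{boundaryM}\,Q)$ iff $\eta\,Q\,Q$ and $\eta\,P\,((\mathit{closure}\,Q)\cap(\mathit{closure}\,(\mathit{compl}\,Q)))$. *)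

theory Defs
  imports Main
begin

text \<open>
  Name-forming operators (\<open>\<inter>\<close>, \<open>pt\<close>, \<open>klass\<close>, \<dots>) are arbitrary functions on names, constrained only
  by the equivalence for \<open>\<eta> P (\<dots>)\<close> that defines them in Ontology. Such an equivalence determines the
  value only up to \<open>\<approx>\<close>, and two names related by \<open>\<equiv>\<close> or \<open>\<approx>\<close> need not be HOL-equal.
\<close>

definition name_eq :: "('n \<Rightarrow> 'n \<Rightarrow> bool) \<Rightarrow> 'n \<Rightarrow> 'n \<Rightarrow> bool" where
  "name_eq \<eta> a b \<longleftrightarrow> (\<forall>P. \<eta> P a \<longleftrightarrow> \<eta> P b)"

definition indiv_eq :: "('n \<Rightarrow> 'n \<Rightarrow> bool) \<Rightarrow> 'n \<Rightarrow> 'n \<Rightarrow> bool" where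
  "indiv_eq \<eta> P Q \<longleftrightarrow> \<eta> P Q \<and> \<eta> Q P"

locale ontology =
  fixes \<eta> :: "'n \<Rightarrow> 'n \<Rightarrow> bool"
    and meet :: "'n \<Rightarrow> 'n \<Rightarrow> 'n"
    and empty_name :: 'n
    and univ_name :: 'n
  assumes ontological_axiom:
      "\<eta> A b \<longleftrightarrow>
        (\<exists>C. \<eta> C A) \<and> (\<forall>C D. \<eta> C A \<and> \<eta> D A \<longrightarrow> \<eta> C D) \<and> (\<forall>C. \<eta> C A \<longrightarrow> \<eta> C b)"
    and meet_iff: "\<eta> P (meet a b) \<longleftrightarrow> \<eta> P a \<and> \<eta> P b"
    and empty_name_iff: "\<not> \<eta> P empty_name"
    and univ_name_iff: "\<eta> P univ_name \<longleftrightarrow> \<eta> P P"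

text \<open>
  Since HOL equality is finer than identity of individuals, antisymmetry of \<open>pt\<close> and uniqueness
  of the m-class are stated up to \<open>indiv_eq\<close>.
\<close>

locale mereology = ontology \<eta> meet empty_name univ_name
  for \<eta> :: "'n \<Rightarrow> 'n \<Rightarrow> bool" and meet empty_name univ_name +
  fixes pt :: "'n \<Rightarrow> 'n"
    and klass :: "'n \<Rightarrow> 'n"
  assumes pt_indiv: "\<eta> A (pt B) \<Longrightarrow> \<eta> B B"
    and pt_refl: "\<eta> A A \<Longrightarrow> \<eta> A (pt A)"
    and pt_antisym: "\<eta> A (pt B) \<Longrightarrow> \<eta> B (pt A) \<Longrightarrow> indiv_eq \<eta> A B"
    and pt_trans: "\<eta> A (pt B) \<Longrightarrow> \<eta> B (pt C) \<Longrightarrow> \<eta> A (pt C)"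
    and klass_iff:
      "\<eta> A (klass a) \<longleftrightarrow>
        \<eta> A A \<and> (\<forall>B. \<eta> B a \<longrightarrow> \<eta> B (pt A)) \<and>
        (\<forall>B. \<eta> B (pt A) \<longrightarrow> (\<exists>C D. \<eta> C a \<and> \<eta> D (pt C) \<and> \<eta> D (pt B)))"
    and klass_exists: "\<eta> A a \<Longrightarrow> \<exists>B. \<eta> B (klass a)"
    and klass_unique: "\<eta> A (klass a) \<Longrightarrow> \<eta> B (klass a) \<Longrightarrow> indiv_eq \<eta> A B"

locale mereotopology = mereology \<eta> meet empty_name univ_name pt klass
  for \<eta> :: "'n \<Rightarrow> 'n \<Rightarrow> bool" and meet empty_name univ_name pt klass +
  fixes ext :: "'n \<Rightarrow> 'n"
    and Universe :: 'n
    and compl :: "'n \<Rightarrow> 'n"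
    and interior :: "'n \<Rightarrow> 'n"
    and closure :: "'n \<Rightarrow> 'n"
    and boundaryM :: "'n \<Rightarrow> 'n"
  assumes ext_iff:
      "\<eta> P (ext Q) \<longleftrightarrow> \<eta> P P \<and> \<eta> Q Q \<and> \<not> (\<exists>D. \<eta> D (pt P) \<and> \<eta> D (pt Q))"
    and Universe_iff: "\<eta> P Universe \<longleftrightarrow> \<eta> P (klass univ_name)"
    and compl_iff:
      "\<eta> P (compl Q) \<longleftrightarrow> \<eta> Q (pt Universe) \<and> \<eta> P (klass (meet (pt Universe) (ext Q)))"
    and interior_iff: "\<eta> P (interior Q) \<longleftrightarrow> \<eta> Q Q \<and> \<eta> P Q"
    and closure_iff:
      "\<eta> P (closure Q) \<longleftrightarrow>
        \<eta> Q Q \<and> (\<exists>R S. \<eta> R (compl Q) \<and> \<eta> S (interior R) \<and> \<eta> P (compl S))"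
    and boundaryM_iff:
      "\<eta> P (boundaryM Q) \<longleftrightarrow> \<eta> Q Q \<and> \<eta> P (meet (closure Q) (closure (compl Q)))"

end

theory Submission
  imports Defs
begin

text \<open>
  An individual is its own interior, so a member of \<open>closure A\<close> is external to the complement
  of \<open>A\<close>. A member \<open>P\<close> of the boundary of \<open>Q\<close> is thus external both to \<open>compl Q\<close> and to
  \<open>compl (compl Q)\<close>. But \<open>compl (compl Q)\<close> is the m-class of everything external to \<open>compl Q\<close>,
  so \<open>P\<close> is also a part of it, a contradiction.
\<close>

lemma (in ontology) eta_left_indiv: "\<eta> A b \<Longrightarrow> \<eta> A A"
  by (metis ontological_axiom)

lemma (in ontology) eta_indiv_sym: "\<eta> A B \<Longrightarrow> \<eta> B B \<Longrightarrow> \<eta> B A"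
  by (metis ontological_axiom)

lemma (in ontology) eta_trans: "\<eta> A B \<Longrightarrow> \<eta> B c \<Longrightarrow> \<eta> A c"
  by (metis ontological_axiom)

lemma (in mereology) indiv_pt: "\<eta> A B \<Longrightarrow> \<eta> B B \<Longrightarrow> \<eta> A (pt B)"
  using eta_trans pt_refl by blast

context mereotopology
begin

text \<open>By \<open>Universe_iff\<close>, an individual \<open>Universe\<close> is itself an
  m-class of \<open>univ_name\<close>, under which every individual falls.\<close>

lemma pt_Universe:
  assumes "\<eta> P P" and "\<eta> Universe Universe"
  shows "\<eta> P (pt Universe)"
  using assms Universe_iff klass_iff univ_name_iff by blast

text \<open>Individuals \<open>S\<close> and \<open>R\<close> with \<open>\<eta> S R\<close> need
  not be HOL-equal, so externality has to be transferred: by symmetry \<open>R\<close> is a part of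
  \<open>S\<close>, hence parts of \<open>R\<close> are parts of \<open>S\<close>.\<close>

lemma ext_eta_cong:
  assumes "\<eta> P (ext S)" and "\<eta> S R" and "\<eta> R R"
  shows "\<eta> P (ext R)"
proof -
  have "\<eta> R (pt S)"
    using assms eta_indiv_sym eta_left_indiv indiv_pt by blast
  then show ?thesis
    using assms ext_iff pt_trans by blast
qed

lemma compl_ext:
  assumes "\<eta> P (compl S)"
  shows "\<eta> P (ext S)"
proof -
  have S: "\<eta> S S" and P: "\<eta> P (klass (meet (pt Universe) (ext S)))"
    using assms compl_iff eta_left_indiv by blast+
  have "\<not> \<eta> D (pt S)" if D: "\<eta> D (pt P)" for D
  proof
    assume "\<eta> D (pt S)"
    \<comment> \<open>The last clause of \<open>klass_iff\<close> makes \<open>D\<close> overlap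
      some \<open>C\<close> external to \<open>S\<close>; the shared part \<open>E\<close> then lies
      in both \<open>C\<close> and \<open>S\<close>.\<close>
    moreover obtain C E where "\<eta> C (ext S)" "\<eta> E (pt C)" "\<eta> E (pt D)"
      using P D klass_iff meet_iff by blast
    ultimately show False
      using ext_iff pt_trans by blast
  qed
  then show ?thesis
    using S P eta_left_indiv ext_iff by blast
qed

lemma closure_ext_compl:
  assumes "\<eta> P (closure A)"
  obtains R where "\<eta> R (compl A)" and "\<eta> P (ext R)"
proof -
  obtain R S where R: "\<eta> R (compl A)" and S: "\<eta> S (interior R)" and P: "\<eta> P (compl S)"
    using assms closure_iff by blast
  have "\<eta> P (ext R)"
    using ext_eta_cong[OF compl_ext[OF P]] S interior_iff by blast
  with R show thesis by (rule that)
qed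

lemma ext_pt_compl:
  assumes "\<eta> P (ext A)" and "\<eta> R (compl A)"
  shows "\<eta> P (pt R)"
proof -
  \<comment> \<open>\<open>compl_iff\<close> puts \<open>A\<close> among the parts of
    \<open>Universe\<close>, which makes \<open>Universe\<close> an individual.\<close>
  have "\<eta> P (pt Universe)"
    using assms compl_iff pt_indiv eta_left_indiv pt_Universe by blast
  then show ?thesis
    using assms compl_iff klass_iff meet_iff by blast
qed

lemma boundaryM_empty: "\<not> \<eta> P (boundaryM Q)"
proof
  assume "\<eta> P (boundaryM Q)"
  then have cl: "\<eta> P (closure Q)" and clc: "\<eta> P (closure (compl Q))"
    using boundaryM_iff meet_iff by blast+
  obtain R where "\<eta> R (compl Q)" and "\<eta> P (ext R)"
    using cl by (rule closure_ext_compl)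
  \<comment> \<open>A closure has members only if its argument is an individual; this lets
    externality pass from \<open>R\<close> to the name \<open>compl Q\<close>.\<close>
  moreover have "\<eta> (compl Q) (compl Q)"
    using clc closure_iff by blast
  ultimately have ext_compl: "\<eta> P (ext (compl Q))"
    using ext_eta_cong by blast
  obtain R' where R': "\<eta> R' (compl (compl Q))" and ext_R': "\<eta> P (ext R')"
    using clc by (rule closure_ext_compl)
  have "\<eta> P (pt R')"
    using ext_compl R' by (rule ext_pt_compl)
  \<comment> \<open>\<open>P\<close> itself is the forbidden common part of \<open>P\<close> and
    \<open>R'\<close>.\<close>
  with ext_R' show False
    using ext_iff pt_refl by blast
qed

end

theorem theorem2:
  fixes \<eta> :: "'n \<Rightarrow> 'n \<Rightarrow> bool"
    and meet :: "'n \<Rightarrow> 'n \<Rightarrow> 'n"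
    and empty_name univ_name Universe Q :: 'n
    and pt klass ext compl interior closure boundaryM :: "'n \<Rightarrow> 'n"
  assumes "mereotopology \<eta> meet empty_name univ_name pt klass
             ext Universe compl interior closure boundaryM"
    and "\<eta> Q Q"
    and "\<not> indiv_eq \<eta> Q Universe"
  shows "name_eq \<eta> (boundaryM Q) empty_name"
proof -
  interpret mereotopology \<eta> meet empty_name univ_name pt klass
      ext Universe compl interior closure boundaryM
    by (rule assms(1))
  show ?thesis
    by (simp add: name_eq_def boundaryM_empty empty_name_iff)
qed

end
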